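(* Let $4 \le p \le q$ and let $D$ be a strong orientation of $K(3,p,q)$ with diameter two, with parts $V_1=\{x_1,x_2,x_3\}$, $V_2$ ($|V_2|=p$), $V_3$ ($|V_3|=q$). If exactly three of the eight sets $V_2^A$ ($A \subseteq \{1,2,3\}$) are nonempty, then $$q \le 1 + \binom{p-3}{\lfloor \frac{p-3}{2} \rfloor} + \binom{p-1}{\lfloor \frac{p-1}{2} \rfloor} + \binom{p}{\lfloor \frac{p}{2} \rfloor}.$$
   Context: $K(3,p,q)$ is the complete tripartite graph with parts $V_1=\{x_1,x_2,x_3\}$, $V_2$ of size $p$, $V_3$ of size $q$. A strong orientation is an orientation of all edges making the digraph strongly connected; its diameter is the maximum directed distance between ordered pairs of vertices. Write $u\to v$ if the edge $uv$ is oriented from $u$ to $v$. For $A \subseteq [3]=\{1,2,3\}$, let $N_D^A$ be the set of vertices $w$ such that $x_i \to w$ for all $i \in A$ and $w \to x_j$ for all $j \in [3]\setminus A$, and $V_2^A = V_2 \cap N_D^A$. The eight sets $V_2^A$ partition $V_2$. *)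

theory Defs
  imports "Graph_Theory.Graph_Theory"
begin

text \<open>
  As in \<open>Graph_Theory\<close>, an undirected simple graph is a symmetric loop-free digraph, each
  edge \<open>uv\<close> being represented by the two arcs \<open>(u, v)\<close> and \<open>(v, u)\<close>.
  The parts of the complete tripartite graph are meant to be pairwise disjoint.
\<close>

definition complete_tripartite :: "'a set \<Rightarrow> 'a set \<Rightarrow> 'a set \<Rightarrow> 'a pair_pre_digraph" where
  "complete_tripartite V1 V2 V3 =
     \<lparr> pverts = V1 \<union> V2 \<union> V3,
       parcs = V1 \<times> (V2 \<union> V3) \<union> V2 \<times> (V1 \<union> V3) \<union> V3 \<times> (V1 \<union> V2) \<rparr>"

definition orientation_of :: "'a pair_pre_digraph \<Rightarrow> 'a pair_pre_digraph \<Rightarrow> bool" where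
  "orientation_of D G \<longleftrightarrow>
     pverts D = pverts G \<and> parcs D \<subseteq> parcs G \<and>
     (\<forall>(u, v) \<in> parcs G. ((u, v) \<in> parcs D) \<noteq> ((v, u) \<in> parcs D))"

definition strong_orientation_of :: "'a pair_pre_digraph \<Rightarrow> 'a pair_pre_digraph \<Rightarrow> bool" where
  "strong_orientation_of D G \<longleftrightarrow> orientation_of D G \<and> strongly_connected (with_proj D)"

text \<open>
  The distance from \<open>u\<close> to \<open>v\<close> is the \<open>Graph_Theory\<close> shortest-path cost \<open>\<mu>\<close> for
  unit arc weights, \<open>\<infinity>\<close> if \<open>v\<close> is not reachable from \<open>u\<close>.
  On a finite nonempty vertex set the suprema are maxima.
\<close>

definition diameter :: "('a, 'b) pre_digraph \<Rightarrow> ereal" where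
  "diameter G = (SUP u\<in>verts G. SUP v\<in>verts G. wf_digraph.\<mu> G (\<lambda>_. 1) u v)"

definition N_class :: "'a pair_pre_digraph \<Rightarrow> (nat \<Rightarrow> 'a) \<Rightarrow> nat set \<Rightarrow> 'a set" where
  "N_class D x A =
     {w \<in> pverts D. (\<forall>i\<in>A. x i \<rightarrow>\<^bsub>with_proj D\<^esub> w) \<and>
                    (\<forall>j\<in>{1, 2, 3} - A. w \<rightarrow>\<^bsub>with_proj D\<^esub> x j)}"

end

theory Submission
  imports Defs
begin

text \<open>
  Give every vertex \<open>v\<close> outside \<open>V1\<close> the type \<open>{i. x i \<rightarrow> v}\<close>. As all distances are at most two,
  the arc between \<open>v \<in> V2\<close> and \<open>w \<in> V3\<close> is forced when their types are comparable, their types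
  are never equal, and the out-neighbourhoods in \<open>V2\<close> of the \<open>w \<in> V3\<close> of a common type form
  an antichain. By Sperner's theorem, \<open>V3\<close> has at most \<open>b n\<close> vertices of type \<open>A\<close>, where
  \<open>b n = n choose (n div 2)\<close> and \<open>n\<close> counts the vertices of \<open>V2\<close> whose type is incomparable
  to \<open>A\<close>. As three types occur in \<open>V2\<close>, summing over the five others gives at most
  \<open>1 + 2 b (p - 2) + 2 b (p - 1)\<close>, which suffices, unless the three types are \<open>{i}, {j}, {i, j}\<close>
  or, dually, their complements. In that case a vertex of \<open>V3\<close> of type \<open>{i, k}\<close> must dominate some
  vertex of type \<open>{j}\<close>, which removes a degree of freedom when that vertex is unique.
\<close>

section \<open>Sperner's theorem by the LYM inequality\<close>

definition mid_binomial :: "nat \<Rightarrow> nat" where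
  "mid_binomial n = n choose (n div 2)"

lemma binomial_le_mid_binomial: "n choose k \<le> mid_binomial n"
  by (simp add: mid_binomial_def binomial_maximum)

lemma mid_binomial_pos: "0 < mid_binomial n"
  by (simp add: mid_binomial_def)

text \<open>Induction on the size of \<open>S\<close>. Unless \<open>S\<close> itself is a member,
  \<open>1 / (n choose k)\<close> equals \<open>(n - k) / n\<close> times
  \<open>1 / ((n - 1) choose k)\<close>. So the weight of \<open>A\<close> can be spread over the
  points \<open>x\<close> outside \<open>A\<close>, as a weight of \<open>A\<close> inside
  \<open>S - {x}\<close>. The total is then an average over \<open>x\<close> of sums bounded by the
  induction hypothesis.\<close>

lemma lym_inequality:
  assumes "finite S" "F \<subseteq> Pow S" "\<And>A B. A \<in> F \<Longrightarrow> B \<in> F \<Longrightarrow> A \<subseteq> B \<Longrightarrow> A = B"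
  shows "(\<Sum>A\<in>F. 1 / real (card S choose card A)) \<le> 1"
  using assms
proof (induction "card S" arbitrary: S F rule: less_induct)
  case less
  have finF: "finite F"
    using less.prems(1,2) by (meson finite_Pow_iff finite_subset)
  show ?case
  proof (cases "S \<in> F")
    case True
    then have "F = {S}" using less.prems by blast
    then show ?thesis by simp
  next
    case False
    show ?thesis
    proof (cases "S = {}")
      case True
      then have "F = {}" using False less.prems(2) by auto
      then show ?thesis by simp
    next
      case nonempty: False
      define n where "n = card S"
      have n: "n > 0" using nonempty less.prems(1) by (simp add: n_def card_gt_0_iff)
      have weight: "1 / real (n choose card A) =
          (\<Sum>x\<in>{x\<in>S. x \<notin> A}. 1 / real ((n - 1) choose card A)) / n" if "A \<in> F" for A
      proof -
        have A: "A \<subset> S" using that less.prems(2) False by blast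
        then have less: "card A < n" using less.prems(1) by (simp add: n_def psubset_card_mono)
        have "{x\<in>S. x \<notin> A} = S - A" by auto
        then have card: "card {x\<in>S. x \<notin> A} = n - card A"
          using A less.prems(1) unfolding n_def
            by (metis card_Diff_subset finite_subset psubset_imp_subset)
        have "n * ((n - 1) choose card A) = (n - card A) * (n choose card A)"
          using binomial_absorb_comp[of n "card A"] by simp
        then have "real n * ((n - 1) choose card A) = (n - card A) * (n choose card A)"
          by (metis of_nat_mult)
        moreover have "(n - 1) choose card A > 0" "n choose card A > 0"
          using less by auto
        ultimately show ?thesis
          using n by (simp add: card field_simps)
      qed
      have "(\<Sum>A\<in>F. 1 / real (n choose card A)) =
          (\<Sum>A\<in>F. \<Sum>x\<in>{x\<in>S. x \<notin> A}. 1 / real ((n - 1) choose card A)) / n"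
        using weight by (simp add: sum_divide_distrib)
      \<comment> \<open>Double counting of the pairs of a member \<open>A\<close> and a point
        outside it. For fixed \<open>x\<close>, the members avoiding \<open>x\<close> are again an
        antichain, now in \<open>S - {x}\<close>.\<close>
      also have "(\<Sum>A\<in>F. \<Sum>x\<in>{x\<in>S. x \<notin> A}. 1 / real ((n - 1) choose card A)) =
          (\<Sum>x\<in>S. \<Sum>A\<in>{A\<in>F. x \<notin> A}. 1 / real ((n - 1) choose card A))"
        by (rule sum.swap_restrict) (use finF less.prems(1) in auto)
      also have "\<dots> \<le> (\<Sum>x\<in>S. 1)"
      proof (rule sum_mono)
        fix x assume x: "x \<in> S"
        have card: "card (S - {x}) = n - 1" using x less.prems(1) by (simp add: n_def)
        have "(\<Sum>A\<in>{A\<in>F. x \<notin> A}. 1 / real (card (S - {x}) choose card A)) \<le> 1"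
        proof (rule less.hyps)
          show "card (S - {x}) < card S" using card n n_def by simp
          show "{A\<in>F. x \<notin> A} \<subseteq> Pow (S - {x})" using less.prems(2) by auto
        qed (use less.prems in auto)
        then show "(\<Sum>A\<in>{A\<in>F. x \<notin> A}. 1 / real ((n - 1) choose card A)) \<le> 1"
          by (simp only: card)
      qed
      finally show ?thesis using n by (simp add: n_def divide_right_mono field_simps)
    qed
  qed
qed

lemma sperner:
  assumes "finite S" "F \<subseteq> Pow S" "\<And>A B. A \<in> F \<Longrightarrow> B \<in> F \<Longrightarrow> A \<subseteq> B \<Longrightarrow> A = B"
  shows "card F \<le> mid_binomial (card S)"
proof -
  have "card F / real (mid_binomial (card S)) = (\<Sum>A\<in>F. 1 / real (mid_binomial (card S)))"
    by simp
  also have "\<dots> \<le> (\<Sum>A\<in>F. 1 / real (card S choose card A))"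
  proof (rule sum_mono)
    fix A assume "A \<in> F"
    then have "card S choose card A > 0"
      using assms(1,2) by (auto intro!: zero_less_binomial card_mono)
    then show "1 / real (mid_binomial (card S)) \<le> 1 / real (card S choose card A)"
      by (intro divide_left_mono) (auto simp: binomial_le_mid_binomial mid_binomial_pos)
  qed
  also have "\<dots> \<le> 1" by (rule lym_inequality[OF assms])
  finally show ?thesis by (simp add: divide_le_eq mid_binomial_pos)
qed

section \<open>Growth of the largest binomial coefficients\<close>

lemma mid_binomial_even: "mid_binomial (2 * m + 2) = 2 * mid_binomial (2 * m + 1)"
proof -
  have "(2 * m + 1) choose m = (2 * m + 1) choose (m + 1)"
    by (subst binomial_symmetric) auto
  then show ?thesis by (simp add: mid_binomial_def)
qed

lemma mid_binomial_odd: "(m + 1) * mid_binomial (2 * m + 1) = (2 * m + 1) * mid_binomial (2 * m)"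
proof -
  have "(2 * m + 1 - m) * ((2 * m + 1) choose m) = (2 * m + 1) * ((2 * m + 1 - 1) choose m)"
    by (rule binomial_absorb_comp)
  moreover have "2 * m + 1 - m = m + 1" "2 * m + 1 - 1 = 2 * m" by auto
  moreover have "(2 * m + 1) div 2 = m" "2 * m div 2 = m" by auto
  ultimately show ?thesis by (simp add: mid_binomial_def del: binomial_Suc_Suc)
qed

lemma mid_binomial_Suc_le: "mid_binomial (Suc n) \<le> 2 * mid_binomial n"
proof (cases "Suc n div 2")
  case (Suc k)
  have "Suc n choose Suc k = (n choose k) + (n choose Suc k)" by simp
  then show ?thesis
    using binomial_le_mid_binomial[of n k] binomial_le_mid_binomial[of n "Suc k"] Suc
    by (simp add: mid_binomial_def[of "Suc n"])
qed (simp add: mid_binomial_def)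

lemma mid_binomial_mono: "m \<le> n \<Longrightarrow> mid_binomial m \<le> mid_binomial n"
proof (induction rule: dec_induct)
  case (step n)
  have "mid_binomial n \<le> Suc n choose (n div 2)"
    by (cases "n div 2") (auto simp: mid_binomial_def)
  also have "\<dots> \<le> mid_binomial (Suc n)" by (rule binomial_le_mid_binomial)
  finally show ?case using step by simp
qed simp

text \<open>At \<open>n = card V - 3\<close> this turns the sum of the class bounds into the bound
  of the theorem. By the parity recurrences, all terms are expressed through
  \<open>mid_binomial (n + 1)\<close> for even \<open>n\<close>, and through
  \<open>mid_binomial n\<close> and \<open>mid_binomial (n + 2)\<close> for odd
  \<open>n\<close>.\<close>

lemma mid_binomial_increment:
  assumes "1 \<le> n"
  shows "mid_binomial (n + 2) + 2 * mid_binomial (n + 1)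
      \<le> mid_binomial (n + 3) + mid_binomial n"
proof (cases "even n")
  case True
  then obtain k where "n = 2 * k" by blast
  then obtain m where n: "n = 2 * m + 2" using assms by (cases k) auto
  define K where "K = real (mid_binomial (n + 1))"
  have "2 * (m + 1) = n" "2 * (m + 2) = n + 2" using n by auto
  note step = mid_binomial_odd[of "m + 1", unfolded this]
    mid_binomial_even[of "m + 1", unfolded this] mid_binomial_odd[of "m + 2", unfolded this]
  have "(m + 2) * mid_binomial (n + 1) = (2 * m + 3) * mid_binomial n"
    using step(1) n by (simp add: eval_nat_numeral)
  from arg_cong[OF this, of real]
  have "real (m + 2) * K = real (2 * m + 3) * real (mid_binomial n)"
    by (simp only: K_def of_nat_mult)
  then have a: "real (mid_binomial n) = K * real (m + 2) / real (2 * m + 3)"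
    by (simp add: field_simps)
  have b: "real (mid_binomial (n + 2)) = 2 * K"
    using step(2) by (simp add: K_def)
  have "(m + 3) * mid_binomial (n + 3) = (2 * m + 5) * mid_binomial (n + 2)"
    using step(3) n by (simp add: eval_nat_numeral)
  from arg_cong[OF this, of real]
  have "real (m + 3) * real (mid_binomial (n + 3)) = real (2 * m + 5) * real (mid_binomial (n + 2))"
    by (simp only: of_nat_mult)
  then have c: "real (mid_binomial (n + 3)) = 2 * K * real (2 * m + 5) / real (m + 3)"
    unfolding b by (simp add: field_simps)
  \<comment> \<open>What remains after division by \<open>K\<close>, because 4 - 2(2m+5)/(m+3) =
    2/(m+3). Cleared of denominators it says 4y + 6 \<le> y^2 + 5y + 6.\<close>
  have frac: "2 / (y + 3) \<le> (y + 2) / (2 * y + 3)" if "0 \<le> y" for y :: real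
    using that by (simp add: frac_le_eq divide_le_0_iff) (simp add: algebra_simps)
  have "4 * K = 2 * K * real (2 * m + 5) / real (m + 3) + K * (2 / (real m + 3))"
    by (simp add: add_divide_distrib[symmetric] eq_divide_eq) (simp add: algebra_simps)
  also have "K * (2 / (real m + 3)) \<le> K * ((real m + 2) / (2 * real m + 3))"
    by (intro mult_left_mono frac) (auto simp: K_def)
  finally have "4 * K \<le> real (mid_binomial (n + 3)) + real (mid_binomial n)"
    unfolding a c by (simp add: ac_simps)
  then show ?thesis using b K_def by linarith
next
  case False
  then obtain m where n: "n = 2 * m + 1" by (elim oddE)
  have e: "2 * (m + 1) = n + 1" using n by auto
  have b: "mid_binomial (n + 1) = 2 * mid_binomial n"
    using mid_binomial_even[of m] n by simp
  have "(m + 2) * mid_binomial (n + 2) = (n + 2) * mid_binomial (n + 1)"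
    using mid_binomial_odd[of "m + 1", unfolded e] by (simp add: eval_nat_numeral)
  also have "\<dots> = (m + 2) * (3 * mid_binomial n) + m * mid_binomial n"
    unfolding b by (simp add: n algebra_simps)
  finally have "(m + 2) * (3 * mid_binomial n) \<le> (m + 2) * mid_binomial (n + 2)"
    by linarith
  then have "3 * mid_binomial n \<le> mid_binomial (n + 2)"
    by (simp only: mult_le_cancel1)
  moreover have "mid_binomial (n + 3) = 2 * mid_binomial (n + 2)"
    using mid_binomial_even[of "m + 1", unfolded e] by (simp add: eval_nat_numeral)
  ultimately show ?thesis using b by linarith
qed

text \<open>Needed for the exceptional types, where two classes can each be as large as
  \<open>mid_binomial (card V - 2)\<close>.\<close>

lemma mid_binomial_convex:
  assumes "1 \<le> n"
  shows "2 * mid_binomial (n + 1) \<le> mid_binomial (n + 2) + mid_binomial n"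
proof -
  have "mid_binomial (n + 3) \<le> 2 * mid_binomial (n + 2)"
    using mid_binomial_Suc_le[of "n + 2"] by (simp add: eval_nat_numeral)
  then show ?thesis using mid_binomial_increment[OF assms] by linarith
qed

section \<open>Incomparability among the subsets of a three-element set\<close>

text \<open>
  The variable \<open>aS\<close> says that the type \<open>S\<close> occurs in \<open>V2\<close>; the argument of \<open>h\<close> counts the
  occurring types incomparable to a given one. The six excluded patterns are the ones in which
  some type is incomparable to all three.
\<close>

lemma incomparability_profile_bool:
  fixes h :: "nat \<Rightarrow> nat" and a0 a1 a2 a3 a12 a13 a23 a123 :: bool
  assumes "of_bool a0 + of_bool a1 + of_bool a2 + of_bool a3
      + of_bool a12 + of_bool a13 + of_bool a23 + of_bool a123 = (3 :: nat)"
    and "h 0 \<le> h 1" "h 1 \<le> h 2"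
    and "\<not> (a1 \<and> a2 \<and> a12)" "\<not> (a1 \<and> a3 \<and> a13)" "\<not> (a2 \<and> a3 \<and> a23)"
    and "\<not> (a1 \<and> a12 \<and> a13)" "\<not> (a2 \<and> a12 \<and> a23)" "\<not> (a3 \<and> a13 \<and> a23)"
  shows "(if a0 then 0 else h 0) + (if a1 then 0 else h (of_bool a2 + of_bool a3 + of_bool a23))
      + (if a2 then 0 else h (of_bool a1 + of_bool a3 + of_bool a13))
      + (if a3 then 0 else h (of_bool a1 + of_bool a2 + of_bool a12))
      + (if a12 then 0 else h (of_bool a3 + of_bool a13 + of_bool a23))
      + (if a13 then 0 else h (of_bool a2 + of_bool a12 + of_bool a23))
      + (if a23 then 0 else h (of_bool a1 + of_bool a12 + of_bool a13))
      + (if a123 then 0 else h 0) \<le> h 0 + 2 * h 1 + 2 * h 2"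
proof -
  have [simp]: "Suc (Suc 0) = 2" by simp
  \<comment> \<open>Exhaustion of 256 assignments: the first assumption leaves 56 of them, and six
    of these are the excluded patterns.\<close>
  show ?thesis using assms
    by (cases a0; cases a1; cases a2; cases a3; cases a12; cases a13; cases a23; cases a123; simp)
qed

abbreviation incomparable :: "'a set \<Rightarrow> 'a set \<Rightarrow> bool" where
  "incomparable A B \<equiv> \<not> A \<subseteq> B \<and> \<not> B \<subseteq> A"

definition idx :: "nat set" where
  "idx = {1, 2, 3}"

lemma finite_idx: "finite idx"
  by (simp add: idx_def)

lemma Pow_idx: "Pow idx = {{}, {1}, {2}, {3}, {1, 2}, {1, 3}, {2, 3}, {1, 2, 3}}"
  by (simp add: idx_def Pow_insert insert_commute Un_commute)

lemma sum_Pow_idx: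
  fixes f :: "nat set \<Rightarrow> nat"
  shows "sum f (Pow idx) =
    f {} + f {1} + f {2} + f {3} + f {1, 2} + f {1, 3} + f {2, 3} + f {1, 2, 3}"
proof -
  let ?xs = "[{}, {1}, {2}, {3}, {1, 2}, {1, 3}, {2, 3}, {1, 2, 3}] :: nat set list"
  \<comment> \<open>Membership bits tell the eight sets apart; distinctness of Boolean triples is
    easy to decide and carries over to the sets.\<close>
  have "distinct (map (\<lambda>A. (1 \<in> A, 2 \<in> A, 3 \<in> A)) ?xs)"
    by simp
  then have "distinct ?xs" by (simp only: distinct_map)
  then have "sum f (set ?xs) = sum_list (map f ?xs)"
    by (rule sum.distinct_set_conv_list)
  then show ?thesis
    unfolding Pow_idx by (simp add: add.assoc)
qed

lemma card_filter_Pow_idx: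
  assumes "T \<subseteq> Pow idx"
  shows "card {B\<in>T. P B} = (\<Sum>B\<in>Pow idx. of_bool (B \<in> T \<and> P B))"
proof -
  have "{B\<in>T. P B} = Pow idx \<inter> {B. B \<in> T \<and> P B}" using assms by auto
  then show ?thesis by (simp add: finite_idx)
qed

text \<open>The Boolean inequality applied to the truth values of \<open>A \<in> T\<close>. The
  triples in \<open>no_pair\<close> are those wholly incomparable to a singleton, and those in
  \<open>no_copair\<close> the ones wholly incomparable to a two-element type.\<close>

lemma incomparability_profile:
  assumes T: "T \<subseteq> Pow idx" "card T = 3"
    and h: "h 0 \<le> h 1" "h 1 \<le> (h 2 :: nat)"
    and no_pair: "\<And>i j. i \<in> idx \<Longrightarrow> j \<in> idx \<Longrightarrow> i \<noteq> j \<Longrightarrow> \<not> {{i}, {j}, {i, j}} \<subseteq> T"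
    and no_copair: "\<And>i j. i \<in> idx \<Longrightarrow> j \<in> idx \<Longrightarrow> i \<noteq> j \<Longrightarrow>
      \<not> {idx - {i}, idx - {j}, idx - {i, j}} \<subseteq> T"
  shows "(\<Sum>A\<in>Pow idx. if A \<in> T then 0 else h (card {B\<in>T. incomparable A B}))
    \<le> h 0 + 2 * h 1 + 2 * h 2"
proof -
  have "card {B\<in>T. True} = 3" using T(2) by simp
  note three = this[unfolded card_filter_Pow_idx[OF T(1)] sum_Pow_idx, simplified]
  have diff: "idx - {1} = {2, 3}" "idx - {2} = {1, 3}" "idx - {3} = {1, 2}"
    "idx - {1, 2} = {3}" "idx - {1, 3} = {2}" "idx - {2, 3} = {1}" by (auto simp: idx_def)
  note no = no_pair[of 1 2] no_pair[of 1 3] no_pair[of 2 3]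
    no_copair[of 1 2] no_copair[of 1 3] no_copair[of 2 3]
  note no' = no[unfolded diff, simplified idx_def, simplified]
  define c where "c A = card {B\<in>T. incomparable A B}" for A
  note c = c_def card_filter_Pow_idx[OF T(1)] sum_Pow_idx
  have c_eqs: "c {} = 0" "c {1} = of_bool ({2} \<in> T) + of_bool ({3} \<in> T) + of_bool ({2, 3} \<in> T)"
    "c {2} = of_bool ({1} \<in> T) + of_bool ({3} \<in> T) + of_bool ({1, 3} \<in> T)"
    "c {3} = of_bool ({1} \<in> T) + of_bool ({2} \<in> T) + of_bool ({1, 2} \<in> T)"
    "c {1, 2} = of_bool ({3} \<in> T) + of_bool ({1, 3} \<in> T) + of_bool ({2, 3} \<in> T)"
    "c {1, 3} = of_bool ({2} \<in> T) + of_bool ({1, 2} \<in> T) + of_bool ({2, 3} \<in> T)"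
    "c {2, 3} = of_bool ({1} \<in> T) + of_bool ({1, 2} \<in> T) + of_bool ({1, 3} \<in> T)"
    "c {1, 2, 3} = 0"
    unfolding c by simp_all
  show ?thesis
    unfolding c_def[symmetric] sum_Pow_idx c_eqs
    by (rule incomparability_profile_bool) (use three h no' in auto)
qed

section \<open>Counting the vertices of \<open>V3\<close> by type\<close>

text \<open>
  \<open>V\<close> and \<open>W\<close> play the roles of \<open>V2\<close> and \<open>V3\<close>, with types \<open>s\<close> and \<open>t\<close>; \<open>out w\<close> is the set of
  out-neighbours of \<open>w\<close> in \<open>V\<close>.
\<close>

locale two_distance =
  fixes V W :: "'a set" and s t :: "'a \<Rightarrow> nat set" and out :: "'a \<Rightarrow> 'a set"
  assumes fin: "finite V" "finite W"
    and s_sub: "v \<in> V \<Longrightarrow> s v \<subseteq> idx"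
    and t_sub: "w \<in> W \<Longrightarrow> t w \<subseteq> idx"
    and out_sub: "w \<in> W \<Longrightarrow> out w \<subseteq> V"
    and out_type: "w \<in> W \<Longrightarrow> v \<in> out w \<Longrightarrow> \<not> t w \<subseteq> s v"
    and in_type: "w \<in> W \<Longrightarrow> v \<in> V - out w \<Longrightarrow> \<not> s v \<subseteq> t w"
    and antichain: "w \<in> W \<Longrightarrow> w' \<in> W \<Longrightarrow> t w = t w' \<Longrightarrow> out w \<subseteq> out w' \<Longrightarrow> w = w'"
    and to_x: "w \<in> W \<Longrightarrow> i \<in> t w \<Longrightarrow> \<exists>v\<in>out w. i \<notin> s v"
    and from_x: "w \<in> W \<Longrightarrow> i \<in> idx - t w \<Longrightarrow> \<exists>v\<in>V - out w. i \<in> s v"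
begin

text \<open>Reversing every arc complements all types and exchanges out- and in-neighbours, which
  preserves the setting. It reduces the complementary exceptional triples to the pair case.\<close>

lemma reverse: "two_distance V W (\<lambda>v. idx - s v) (\<lambda>w. idx - t w) (\<lambda>w. V - out w)"
proof
  fix w v assume "w \<in> W" "v \<in> V - out w"
  then show "\<not> idx - t w \<subseteq> idx - s v" using in_type[of w v] s_sub[of v] by auto
next
  fix w v assume "w \<in> W" "v \<in> V - (V - out w)"
  then show "\<not> idx - s v \<subseteq> idx - t w" using out_type[of w v] t_sub[of w] by auto
next
  fix w w' assume w: "w \<in> W" "w' \<in> W" "idx - t w = idx - t w'" "V - out w \<subseteq> V - out w'"
  then have "t w' = t w" using t_sub by blast
  moreover have "out w' \<subseteq> out w" using w out_sub by blast
  ultimately show "w = w'" using antichain[of w' w] w by auto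
next
  fix w i assume w: "w \<in> W" "i \<in> idx - t w"
  show "\<exists>v\<in>V - out w. i \<notin> idx - s v" using from_x[OF w] by blast
next
  fix w i assume w: "w \<in> W" "i \<in> idx - (idx - t w)"
  then have "i \<in> t w" by blast
  from to_x[OF w(1) this] out_sub[OF w(1)] w(2)
  show "\<exists>v\<in>V - (V - out w). i \<in> idx - s v" by blast
qed (use fin in auto)

definition T :: "nat set set" where "T = s ` V"

definition size_in :: "nat set \<Rightarrow> nat" where "size_in B = card {v\<in>V. s v = B}"

definition class_of :: "nat set \<Rightarrow> 'a set" where "class_of A = {w\<in>W. t w = A}"

lemma T_sub: "T \<subseteq> Pow idx"
  using s_sub by (auto simp: T_def)

lemma fin_T: "finite T"
  using fin by (simp add: T_def)

lemma size_in_pos: "B \<in> T \<Longrightarrow> 1 \<le> size_in B"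
  unfolding size_in_def T_def using fin by (auto simp: Suc_le_eq card_gt_0_iff)

lemma card_V_filter: "card {v\<in>V. P (s v)} = (\<Sum>B\<in>{B\<in>T. P B}. size_in B)"
proof -
  have "{v\<in>V. P (s v)} = (\<Union>B\<in>{B\<in>T. P B}. {v\<in>V. s v = B})"
    by (auto simp: T_def)
  also have "card \<dots> = (\<Sum>B\<in>{B\<in>T. P B}. size_in B)"
    unfolding size_in_def by (rule card_UN_disjoint) (use fin fin_T in auto)
  finally show ?thesis .
qed

lemma card_V: "card V = (\<Sum>B\<in>T. size_in B)"
  using card_V_filter[of "\<lambda>_. True"] by simp

lemma card_W: "card W = (\<Sum>A\<in>Pow idx. card (class_of A))"
proof -
  have "W = (\<Union>A\<in>Pow idx. class_of A)"
    using t_sub by (auto simp: class_of_def)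
  moreover have "card (\<Union>A\<in>Pow idx. class_of A) = (\<Sum>A\<in>Pow idx. card (class_of A))"
    by (rule card_UN_disjoint) (use fin finite_idx in \<open>auto simp: class_of_def\<close>)
  ultimately show ?thesis by metis
qed

text \<open>With equal types on both ends, \<open>out_type\<close> and \<open>in_type\<close> forbid
  both directions of the arc.\<close>

lemma class_empty: "A \<in> T \<Longrightarrow> class_of A = {}"
  using out_type in_type unfolding class_of_def T_def by blast

text \<open>\<open>F\<close> holds the undetermined positions. Outside \<open>F\<close> the sets
  \<open>out w\<close> of one class agree, so their traces on \<open>F\<close> still form an
  antichain and Sperner's theorem applies.\<close>

lemma card_class_le_free:
  assumes "F \<subseteq> V"
    and "\<And>w v. w \<in> W \<Longrightarrow> t w = A \<Longrightarrow> v \<in> V - F \<Longrightarrow> v \<in> out w \<longleftrightarrow> P v"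
  shows "card (class_of A) \<le> mid_binomial (card F)"
proof -
  have le: "w = w'" if "w \<in> class_of A" "w' \<in> class_of A" "out w \<inter> F \<subseteq> out w' \<inter> F" for w w'
  proof (rule antichain)
    show "out w \<subseteq> out w'"
      using that assms(2)[of w] assms(2)[of w'] out_sub[of w] by (auto simp: class_of_def)
  qed (use that in \<open>auto simp: class_of_def\<close>)
  then have inj: "inj_on (\<lambda>w. out w \<inter> F) (class_of A)"
    by (intro inj_onI) blast
  have "card ((\<lambda>w. out w \<inter> F) ` class_of A) \<le> mid_binomial (card F)"
  proof (rule sperner)
    show "finite F" using assms(1) fin finite_subset by blast
  qed (use le in auto)
  then show ?thesis by (simp add: card_image[OF inj])
qed

lemma comparable_out:
  assumes "w \<in> W" "v \<in> V" "\<not> incomparable (t w) (s v)"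
  shows "v \<in> out w \<longleftrightarrow> s v \<subseteq> t w"
  using out_type[of w v] in_type[of w v] assms by blast

lemma card_class_le:
  "card (class_of A) \<le> mid_binomial (\<Sum>B\<in>{B\<in>T. incomparable A B}. size_in B)"
  unfolding card_V_filter[symmetric]
  by (rule card_class_le_free[where P = "\<lambda>v. s v \<subseteq> A"]) (use comparable_out in auto)

text \<open>Each of the \<open>3 - n\<close> occurring types comparable to \<open>A\<close> uses up
  at least one vertex of \<open>V\<close>. For \<open>n = 0\<close> no position is free at all,
  hence the sharper value 1.\<close>

lemma card_class_le_count:
  assumes "card T = 3"
  shows "card (class_of A) \<le> (let n = card {B\<in>T. incomparable A B} in
    if n = 0 then 1 else mid_binomial (card V - (3 - n)))"
proof -
  define I where "I = {B\<in>T. incomparable A B}"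
  have I: "I \<subseteq> T" "finite I" using fin_T by (auto simp: I_def)
  have "card (T - I) \<le> (\<Sum>B\<in>T - I. size_in B)"
    using sum_mono[of "T - I" "\<lambda>_. 1" size_in] size_in_pos by auto
  moreover have "(\<Sum>B\<in>I. size_in B) + (\<Sum>B\<in>T - I. size_in B) = card V"
    using card_V sum.subset_diff[OF I(1) fin_T, of size_in] by simp
  moreover have "card (T - I) = 3 - card I"
    using I assms(1) by (simp add: card_Diff_subset)
  ultimately have "(\<Sum>B\<in>I. size_in B) \<le> card V - (3 - card I)" by linarith
  then have "mid_binomial (\<Sum>B\<in>I. size_in B) \<le> mid_binomial (card V - (3 - card I))"
    by (rule mid_binomial_mono)
  moreover have "mid_binomial (\<Sum>B\<in>I. size_in B) = 1" if "card I = 0"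
    using that I by (simp add: mid_binomial_def)
  ultimately show ?thesis
    using card_class_le[of A] unfolding Let_def I_def[symmetric] by force
qed

text \<open>By the last two assumptions no type is incomparable to all three occurring ones, so only
  the bounds \<open>h 0\<close>, \<open>h 1\<close> and \<open>h 2\<close> enter the sum.\<close>

lemma card_W_le_generic:
  assumes "card T = 3" "4 \<le> card V"
    and "\<And>i j. i \<in> idx \<Longrightarrow> j \<in> idx \<Longrightarrow> i \<noteq> j \<Longrightarrow> \<not> {{i}, {j}, {i, j}} \<subseteq> T"
    and "\<And>i j. i \<in> idx \<Longrightarrow> j \<in> idx \<Longrightarrow> i \<noteq> j \<Longrightarrow>
      \<not> {idx - {i}, idx - {j}, idx - {i, j}} \<subseteq> T"
  shows "card W \<le> 1 + mid_binomial (card V - 3) + mid_binomial (card V - 1) + mid_binomial (card V)"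
proof -
  define h where "h n = (if n = 0 then 1 else mid_binomial (card V - (3 - n)))" for n
  have "card W \<le> (\<Sum>A\<in>Pow idx. if A \<in> T then 0 else h (card {B\<in>T. incomparable A B}))"
    unfolding card_W
    by (rule sum_mono) (use card_class_le_count[OF assms(1)] class_empty in \<open>auto simp: h_def Let_def\<close>)
  also have "\<dots> \<le> h 0 + 2 * h 1 + 2 * h 2"
  proof (rule incomparability_profile[OF T_sub assms(1)])
    show "h 0 \<le> h 1" using mid_binomial_pos by (simp add: h_def Suc_le_eq)
    show "h 1 \<le> h 2" by (simp add: h_def mid_binomial_mono)
  qed (use assms in auto)
  also have "h 0 + 2 * h 1 + 2 * h 2 = 1 + 2 * mid_binomial (card V - 2) + 2 * mid_binomial (card V - 1)"
    by (simp add: h_def numeral_2_eq_2 numeral_3_eq_3)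
  also have "\<dots> \<le> 1 + mid_binomial (card V - 3) + mid_binomial (card V - 1) + mid_binomial (card V)"
  proof -
    have eqs: "card V - 3 + 2 = card V - 1" "card V - 3 + 1 = card V - 2"
      "card V - 3 + 3 = card V" and le: "1 \<le> card V - 3" using assms(2) by auto
    show ?thesis using mid_binomial_increment[OF le, unfolded eqs] by linarith
  qed
  finally show ?thesis .
qed

text \<open>A vertex of type \<open>{i, k}\<close> must reach \<open>x i\<close> through an
  out-neighbour whose type omits \<open>i\<close>, and \<open>{j}\<close> is the only such type in
  \<open>T\<close>. If a single vertex has type \<open>{j}\<close>, its arc is therefore
  forced.\<close>

lemma card_pair_class_le:
  assumes T: "T = {{i}, {j}, {i, j}}" and ne: "i \<noteq> j" "k \<noteq> i" "k \<noteq> j"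
  shows "card (class_of {i, k}) \<le>
    mid_binomial (if size_in {j} = 1 then size_in {i, j} else size_in {j} + size_in {i, j})"
proof (cases "size_in {j} = 1")
  case False
  have "{B\<in>T. incomparable {i, k} B} = {{j}, {i, j}}"
    using ne by (auto simp: T)
  moreover have "{j} \<noteq> {i, j}" using ne by auto
  ultimately show ?thesis using card_class_le[of "{i, k}"] False by simp
next
  case True
  then obtain u where u: "{v\<in>V. s v = {j}} = {u}"
    by (auto simp: size_in_def card_1_singleton_iff)
  have "card (class_of {i, k}) \<le> mid_binomial (card {v\<in>V. s v = {i, j}})"
  \<comment> \<open>Outside type \<open>{i, j}\<close> everything is an out-neighbour: vertices of
    type \<open>{i}\<close> by comparability, and \<open>u\<close> by the path to
    \<open>x i\<close>.\<close>
  proof (rule card_class_le_free[where P = "\<lambda>_. True"])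
    fix w v assume w: "w \<in> W" "t w = {i, k}" and v: "v \<in> V - {v\<in>V. s v = {i, j}}"
    obtain v' where v': "v' \<in> out w" "i \<notin> s v'"
      using to_x[OF w(1), of i] w(2) by auto
    then have "v' \<in> V" using out_sub w by blast
    then have "s v' \<in> T" by (simp add: T_def)
    then have "s v' = {j}" using v'(2) by (auto simp: T)
    then have "v' = u" using u \<open>v' \<in> V\<close> by blast
    have "s v \<in> T" using v by (simp add: T_def)
    then consider "s v = {i}" | "s v = {j}" using v by (auto simp: T)
    then show "v \<in> out w \<longleftrightarrow> True"
    proof cases
      case 1
      then show ?thesis using comparable_out[of w v] w v by auto
    next
      case 2
      then have "v = u" using u v by blast
      then show ?thesis using \<open>v' = u\<close> v'(1) by simp
    qed
  qed auto
  then show ?thesis using True by (simp add: size_in_def)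
qed

text \<open>Only the types \<open>{k}\<close>, \<open>{i, k}\<close>, \<open>{j, k}\<close> and
  \<open>idx\<close> can occur in \<open>W\<close>. The first contributes at most
  \<open>mid_binomial (card V)\<close> and the last at most 1, so the two middle classes together
  have to account for the other two terms.\<close>

lemma card_W_le_pair:
  assumes "i \<in> idx" "j \<in> idx" "i \<noteq> j" and T: "T = {{i}, {j}, {i, j}}" and V: "4 \<le> card V"
  shows "card W \<le> 1 + mid_binomial (card V - 3) + mid_binomial (card V - 1) + mid_binomial (card V)"
proof -
  obtain k where k: "idx = {i, j, k}" "k \<noteq> i" "k \<noteq> j"
  proof
    \<comment> \<open>The three indices sum to 6.\<close>
    show "idx = {i, j, 6 - i - j}" "6 - i - j \<noteq> i" "6 - i - j \<noteq> j"
      using assms(1-3) by (auto simp: idx_def)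
  qed
  have fin_class: "finite (class_of A)" for A using fin by (simp add: class_of_def)
  have "W \<subseteq> class_of {k} \<union> class_of {i, k} \<union> class_of {j, k} \<union> class_of idx"
  proof
    fix w assume w: "w \<in> W"
    then have sub: "t w \<subseteq> {i, j, k}" using t_sub k(1) by blast
    have "t w \<notin> T"
      using class_empty[of "t w"] w by (auto simp: class_of_def)
    \<comment> \<open>A path from \<open>x k\<close> to \<open>w\<close> would need a vertex of
      \<open>V\<close> whose type contains \<open>k\<close>, and \<open>T\<close> has none.\<close>
    moreover have "t w \<noteq> {}"
    proof
      assume "t w = {}"
      then obtain v where v: "v \<in> V" "k \<in> s v" using from_x[OF w, of k] k(1) by auto
      then have "s v \<in> T" by (simp add: T_def)
      then show False using v(2) k(2,3) by (auto simp: T)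
    qed
    ultimately have "t w \<in> {{k}, {i, k}, {j, k}, {i, j, k}}"
      using sub unfolding T by blast
    then show "w \<in> class_of {k} \<union> class_of {i, k} \<union> class_of {j, k} \<union> class_of idx"
      using w k(1) by (auto simp: class_of_def)
  qed
  then have "card W \<le> card (class_of {k} \<union> class_of {i, k} \<union> class_of {j, k} \<union> class_of idx)"
    using fin_class by (intro card_mono) auto
  also have "\<dots> \<le> card (class_of {k}) + card (class_of {i, k}) + card (class_of {j, k})
      + card (class_of idx)"
    by (meson add_le_mono1 card_Un_le le_trans)
  finally have split: "card W \<le> card (class_of {k}) + card (class_of {i, k})
      + card (class_of {j, k}) + card (class_of idx)" .
  have top: "card (class_of idx) \<le> 1"
  proof -
    have "{B\<in>T. incomparable idx B} = {}" using T_sub by blast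
    from card_class_le[of idx, unfolded this] show ?thesis by (simp add: mid_binomial_def)
  qed
  have single: "card (class_of {k}) \<le> mid_binomial (card V)"
    by (rule card_class_le_free) auto
  define a b c where "a = size_in {i}" and "b = size_in {j}" and "c = size_in {i, j}"
  have ik: "card (class_of {i, k}) \<le> mid_binomial (if b = 1 then c else b + c)"
    using card_pair_class_le[OF T assms(3) k(2,3)] by (simp only: b_def c_def)
  have jk: "card (class_of {j, k}) \<le> mid_binomial (if a = 1 then c else a + c)"
  proof -
    have "T = {{j}, {i}, {j, i}}" and comm: "{j, i} = {i, j}" using T by auto
    from card_pair_class_le[OF this(1) assms(3)[symmetric] k(3,2), unfolded comm]
    show ?thesis by (simp only: a_def c_def)
  qed
  have "{i} \<noteq> {i, j}" "{j} \<noteq> {i, j}" "{i} \<noteq> {j}" using assms(3) by auto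
  then have sum: "a + b + c = card V" by (simp add: card_V T a_def b_def c_def)
  have pos: "1 \<le> a" "1 \<le> b" using size_in_pos T by (auto simp: a_def b_def)
  have "card V - 3 + 2 = card V - 1" "card V - 3 + 1 = card V - 2" "1 \<le> card V - 3"
    using V by auto
  then have convex: "2 * mid_binomial (card V - 2) \<le> mid_binomial (card V - 3) + mid_binomial (card V - 1)"
    using mid_binomial_convex[of "card V - 3"] by simp
  \<comment> \<open>If exactly one of \<open>a\<close>, \<open>b\<close> is 1, the two classes match
    the two terms separately. Otherwise both have at most \<open>card V - 2\<close> free positions,
    and convexity applies.\<close>
  have "card (class_of {i, k}) + card (class_of {j, k}) \<le> mid_binomial (card V - 3) + mid_binomial (card V - 1)"
  proof (cases "a = 1"; cases "b = 1")
    assume "a = 1" "b = 1"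
    then have "c = card V - 2" using sum by simp
    then show ?thesis using ik jk convex \<open>a = 1\<close> \<open>b = 1\<close> by simp
  next
    assume "a = 1" "b \<noteq> 1"
    then have "b + c = card V - 1" "c \<le> card V - 3" using sum pos by auto
    then show ?thesis
      using ik jk mid_binomial_mono[of c "card V - 3"] \<open>a = 1\<close> \<open>b \<noteq> 1\<close> by simp
  next
    assume "a \<noteq> 1" "b = 1"
    then have "a + c = card V - 1" "c \<le> card V - 3" using sum pos by auto
    then show ?thesis
      using ik jk mid_binomial_mono[of c "card V - 3"] \<open>a \<noteq> 1\<close> \<open>b = 1\<close> by simp
  next
    assume "a \<noteq> 1" "b \<noteq> 1"
    then have "a + c \<le> card V - 2" "b + c \<le> card V - 2" using sum pos by auto
    then show ?thesis
      using ik jk convex mid_binomial_mono[of "a + c" "card V - 2"]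
        mid_binomial_mono[of "b + c" "card V - 2"] \<open>a \<noteq> 1\<close> \<open>b \<noteq> 1\<close> by simp
  qed
  then show ?thesis using split top single by linarith
qed

lemma card_W_le:
  assumes "card T = 3" "4 \<le> card V"
  shows "card W \<le> 1 + mid_binomial (card V - 3) + mid_binomial (card V - 1) + mid_binomial (card V)"
proof -
  define pair where "pair i j \<longleftrightarrow> {{i}, {j}, {i, j}} \<subseteq> T" for i j
  define copair where "copair i j \<longleftrightarrow> {idx - {i}, idx - {j}, idx - {i, j}} \<subseteq> T" for i j
  consider (pair) i j where "i \<in> idx" "j \<in> idx" "i \<noteq> j" "pair i j"
    | (copair) i j where "i \<in> idx" "j \<in> idx" "i \<noteq> j" "copair i j"
    | (generic) "\<And>i j. i \<in> idx \<Longrightarrow> j \<in> idx \<Longrightarrow> i \<noteq> j \<Longrightarrow> \<not> pair i j \<and> \<not> copair i j"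
    by blast
  then show ?thesis
  proof cases
    case pair
    have "{i} \<noteq> {i, j}" "{j} \<noteq> {i, j}" "{i} \<noteq> {j}" using pair(3) by auto
    then have "card {{i}, {j}, {i, j}} = 3" by simp
    then have "T = {{i}, {j}, {i, j}}"
      using card_subset_eq[OF fin_T pair(4)[unfolded pair_def]] assms(1) by simp
    then show ?thesis using card_W_le_pair pair(1-3) assms(2) by blast
  next
    case copair
    interpret rev: two_distance V W "\<lambda>v. idx - s v" "\<lambda>w. idx - t w" "\<lambda>w. V - out w"
      by (rule reverse)
    have "idx - {i} \<noteq> idx - {j}" "idx - {i} \<noteq> idx - {i, j}" "idx - {j} \<noteq> idx - {i, j}"
      using copair(1-3) by auto
    then have "card {idx - {i}, idx - {j}, idx - {i, j}} = 3" by simp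
    then have T: "T = {idx - {i}, idx - {j}, idx - {i, j}}"
      using card_subset_eq[OF fin_T copair(4)[unfolded copair_def]] assms(1) by simp
    have "rev.T = (\<lambda>A. idx - A) ` T"
      unfolding rev.T_def T_def by (simp add: image_image)
    also have "\<dots> = {{i}, {j}, {i, j}}"
      unfolding T using copair(1,2) by (simp add: double_diff)
    finally show ?thesis using rev.card_W_le_pair copair(1-3) assms(2) by blast
  next
    case generic
    show ?thesis
      by (rule card_W_le_generic) (use assms generic in \<open>auto simp: pair_def copair_def\<close>)
  qed
qed

end

section \<open>From diameter two to the counting setting\<close>

lemma diameter_le_2D:
  assumes "wf_digraph (with_proj D)" "diameter (with_proj D) = 2"
    and "u \<in> pverts D" "v \<in> pverts D"
  shows "u = v \<or> (u, v) \<in> parcs D \<or> (\<exists>z. (u, z) \<in> parcs D \<and> (z, v) \<in> parcs D)"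
proof -
  interpret wf_digraph "with_proj D" by fact
  have "\<mu> (\<lambda>_. 1) u v \<le> diameter (with_proj D)"
    unfolding diameter_def
    by (rule SUP_upper2[of u], use assms(3) in simp, rule SUP_upper) (use assms(4) in simp)
  \<comment> \<open>A strict bound on the infimum yields an actual walk, and unit costs then give it
    at most two arcs.\<close>
  also have "\<dots> < 3" using assms(2) by simp
  finally obtain es where es: "awalk u es v" "awalk_cost (\<lambda>_. 1) es < 3"
    unfolding \<mu>_def INF_less_iff by auto
  have "awalk_cost (\<lambda>_. 1) es = length es"
    by (induction es) auto
  then have "length es < 3" using es(2) by simp
  then consider "es = []" | e where "es = [e]" | e f where "es = [e, f]"
    by (cases es rule: remdups_adj.cases) (auto simp: length_Suc_conv less_Suc_eq numeral_3_eq_3)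
  then show ?thesis
  proof cases
    case 1
    then show ?thesis using es(1) by (simp add: awalk_Nil_iff)
  next
    case 2
    then show ?thesis using es(1) by (cases e) (auto simp: awalk_Cons_iff awalk_Nil_iff)
  next
    case 3
    then show ?thesis using es(1)
      by (cases e; cases f) (auto simp: awalk_Cons_iff awalk_Nil_iff)
  qed
qed

theorem theorem4p12:
  fixes D :: "'a pair_pre_digraph" and x :: "nat \<Rightarrow> 'a" and V1 V2 V3 :: "'a set"
    and p q :: nat
  assumes "4 \<le> p" and "p \<le> q"
    and "inj_on x {1, 2, 3}" and "V1 = {x 1, x 2, x 3}"
    and "finite V2" and "card V2 = p" and "finite V3" and "card V3 = q"
    and "V1 \<inter> V2 = {}" and "V1 \<inter> V3 = {}" and "V2 \<inter> V3 = {}"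
    and "strong_orientation_of D (complete_tripartite V1 V2 V3)"
    and "diameter (with_proj D) = 2"
    and "card {A. A \<subseteq> {1, 2, 3} \<and> V2 \<inter> N_class D x A \<noteq> {}} = 3"
  shows "q \<le> 1 + ((p - 3) choose ((p - 3) div 2)) + ((p - 1) choose ((p - 1) div 2))
              + (p choose (p div 2))"
proof -
  have ori: "pverts D = V1 \<union> V2 \<union> V3"
      "parcs D \<subseteq> V1 \<times> (V2 \<union> V3) \<union> V2 \<times> (V1 \<union> V3) \<union> V3 \<times> (V1 \<union> V2)"
      "\<And>u v. (u, v) \<in> V1 \<times> (V2 \<union> V3) \<union> V2 \<times> (V1 \<union> V3) \<union> V3 \<times> (V1 \<union> V2) \<Longrightarrow>
        ((u, v) \<in> parcs D) \<noteq> ((v, u) \<in> parcs D)"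
    using assms(12) unfolding strong_orientation_of_def orientation_of_def complete_tripartite_def
    by auto
  have "wf_digraph (with_proj D)"
    by (rule wf_digraph.intro) (use ori(1,2) in auto)
  note reach = diameter_le_2D[OF this assms(13), unfolded ori(1)]
  have arc: "(u \<in> V1 \<longrightarrow> v \<notin> V1) \<and> (u \<in> V2 \<longrightarrow> v \<notin> V2) \<and> (u \<in> V3 \<longrightarrow> v \<notin> V3)"
      "u \<in> V1 \<union> V2 \<union> V3" "v \<in> V1 \<union> V2 \<union> V3" if "(u, v) \<in> parcs D" for u v
    using subsetD[OF ori(2) that] assms(9-11) by auto
  have V1: "x i \<in> V1" if "i \<in> idx" for i using that assms(4) by (auto simp: idx_def)
  have V1E: "\<exists>i\<in>idx. u = x i" if "u \<in> V1" for u using that assms(4) by (auto simp: idx_def)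
  define ty where "ty w = {i\<in>idx. (x i, w) \<in> parcs D}" for w
  define out where "out w = {v\<in>V2. (w, v) \<in> parcs D}" for w
  have flip: "(w, x i) \<in> parcs D \<longleftrightarrow> i \<notin> ty w" if "i \<in> idx" "w \<in> V2 \<union> V3" for i w
    using ori(3)[of "x i" w] V1[OF that(1)] that unfolding ty_def by blast
  have flip23: "(v, w) \<in> parcs D \<longleftrightarrow> v \<notin> out w" if "w \<in> V3" "v \<in> V2" for v w
    using ori(3)[of v w] that unfolding out_def by blast
  \<comment> \<open>Each property comes from a two-arc path against a missing arc. Between
    \<open>V2\<close> and \<open>V3\<close> its midpoint must lie in \<open>V1\<close>, and between
    \<open>V3\<close> and \<open>V1\<close> in \<open>V2\<close>, since no arc stays within a
    part.\<close>
  interpret two_distance V2 V3 ty ty out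
  proof
    fix w v assume w: "w \<in> V3" and v: "v \<in> out w"
    then have v2: "v \<in> V2" "(v, w) \<notin> parcs D" "v \<noteq> w"
      using flip23[OF w, of v] assms(11) by (auto simp: out_def)
    then obtain z where z: "(v, z) \<in> parcs D" "(z, w) \<in> parcs D"
      using reach[of v w] w by auto
    then have "z \<in> V1" using arc[OF z(1)] arc[OF z(2)] v2(1) w by blast
    then obtain i where i: "i \<in> idx" "z = x i" using V1E by blast
    then have "i \<in> ty w" using z(2) by (simp add: ty_def)
    moreover have "i \<notin> ty v" using flip[OF i(1), of v] z(1) i(2) v2(1) by simp
    ultimately show "\<not> ty w \<subseteq> ty v" by blast
  next
    fix w v assume w: "w \<in> V3" and v: "v \<in> V2 - out w"
    then have v2: "v \<in> V2" "(w, v) \<notin> parcs D" "v \<noteq> w"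
      using assms(11) by (auto simp: out_def)
    then obtain z where z: "(w, z) \<in> parcs D" "(z, v) \<in> parcs D"
      using reach[of w v] w by auto
    then have "z \<in> V1" using arc[OF z(1)] arc[OF z(2)] v2(1) w by blast
    then obtain i where i: "i \<in> idx" "z = x i" using V1E by blast
    then have "i \<in> ty v" using z(2) by (simp add: ty_def)
    moreover have "i \<notin> ty w" using flip[OF i(1), of w] z(1) i(2) w by simp
    ultimately show "\<not> ty v \<subseteq> ty w" by blast
  next
    fix w w' assume w: "w \<in> V3" "w' \<in> V3" "ty w = ty w'" "out w \<subseteq> out w'"
    show "w = w'"
    proof (rule ccontr)
      assume "w \<noteq> w'"
      moreover have "(w, w') \<notin> parcs D" using arc[of w w'] w(1,2) by blast
      ultimately obtain z where z: "(w, z) \<in> parcs D" "(z, w') \<in> parcs D"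
        using reach[of w w'] w by auto
      then have "z \<in> V1 \<union> V2" using arc[OF z(1)] w(1) by blast
      \<comment> \<open>A midpoint in \<open>V1\<close> would distinguish the types of
        \<open>w\<close> and \<open>w'\<close>; one in \<open>V2\<close> would lie in
        \<open>out w\<close> but not in \<open>out w'\<close>.\<close>
      then show False
      proof
        assume "z \<in> V1"
        then obtain i where i: "i \<in> idx" "z = x i" using V1E by blast
        then have "i \<in> ty w'" using z(2) by (simp add: ty_def)
        moreover have "i \<notin> ty w" using flip[OF i(1), of w] z(1) i(2) w by simp
        ultimately show False using w(3) by simp
      next
        assume "z \<in> V2"
        then have "z \<in> out w" using z(1) by (simp add: out_def)
        moreover have "z \<notin> out w'" using flip23[OF w(2) \<open>z \<in> V2\<close>] z(2) by simp
        ultimately show False using w(4) by blast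
      qed
    qed
  next
    fix w i assume w: "w \<in> V3" and i: "i \<in> ty w"
    then have idx: "i \<in> idx" by (simp add: ty_def)
    have "(w, x i) \<notin> parcs D" "w \<noteq> x i"
      using flip[OF idx, of w] w i V1[OF idx] assms(10) by auto
    then obtain z where z: "(w, z) \<in> parcs D" "(z, x i) \<in> parcs D"
      using reach[of w "x i"] w V1[OF idx] by auto
    then have "z \<in> V2" using arc[OF z(1)] arc[OF z(2)] w V1[OF idx] by blast
    moreover have "i \<notin> ty z" using flip[OF idx, of z] z(2) \<open>z \<in> V2\<close> by simp
    ultimately show "\<exists>v\<in>out w. i \<notin> ty v" using z(1) by (auto simp: out_def)
  next
    fix w i assume w: "w \<in> V3" and i: "i \<in> idx - ty w"
    then have idx: "i \<in> idx" and "(x i, w) \<notin> parcs D" by (auto simp: ty_def)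
    moreover have "w \<noteq> x i" using w V1[OF idx] assms(10) by auto
    ultimately obtain z where z: "(x i, z) \<in> parcs D" "(z, w) \<in> parcs D"
      using reach[of "x i" w] w V1[OF idx] by auto
    then have "z \<in> V2" using arc[OF z(1)] arc[OF z(2)] w V1[OF idx] by blast
    moreover have "z \<notin> out w" using flip23[OF w \<open>z \<in> V2\<close>] z(2) by simp
    moreover have "i \<in> ty z" using z(1) idx by (simp add: ty_def)
    ultimately show "\<exists>v\<in>V2 - out w. i \<in> ty v" by blast
  qed (use assms(5,7) in \<open>auto simp: ty_def out_def\<close>)
  have mem_class: "v \<in> N_class D x A \<longleftrightarrow> ty v = A" if "A \<subseteq> idx" "v \<in> V2" for A v
  proof -
    have "v \<in> N_class D x A \<longleftrightarrow> (\<forall>i\<in>A. i \<in> ty v) \<and> (\<forall>j\<in>idx - A. j \<notin> ty v)"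
      using that ori(1) flip[of _ v] unfolding N_class_def idx_def[symmetric]
      by (auto simp: ty_def)
    also have "\<dots> \<longleftrightarrow> ty v = A" using that(1) by (auto simp: ty_def)
    finally show ?thesis .
  qed
  have "{A. A \<subseteq> {1, 2, 3} \<and> V2 \<inter> N_class D x A \<noteq> {}} = T"
    unfolding idx_def[symmetric] T_def using mem_class by (auto simp: ty_def)
  then have "card T = 3" using assms(14) by simp
  from card_W_le[OF this] show ?thesis
    using assms(1,6,8) by (simp add: mid_binomial_def)
qed

end
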